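(* Let $d$ be an odd positive integer which is not a perfect square. Then there does not exist a $d\times d$ unitary matrix $D$ of even multiplicative order $2r$ (with $r\ge 1$) whose powers $D, D^2, \dots, D^{2r}=I$ generate $2r$ pairwise mutually unbiased bases of $\mathbb{C}^d$, i.e. such that for all $1\le i\ne j\le 2r$ every entry of $D^{i}(D^{j})^{-1}$ has absolute value $1/\sqrt{d}$.
   Context: Two orthonormal bases $\{u_1,\dots,u_d\}$ and $\{v_1,\dots,v_d\}$ of $\mathbb{C}^d$ (with respect to a positive definite hermitian form) are mutually unbiased if $|\langle u_i,v_j\rangle|^2=1/d$ for all $1\le i,j\le d$. Identifying orthonormal bases with $d\times d$ unitary matrices $U_1,U_2$, this is the condition that every entry of $U_1U_2^{-1}=U_1U_2^\dagger$ has absolute value $1/\sqrt d$. *)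

theory Defs
  imports
    "Jordan_Normal_Form.Schur_Decomposition"
    "HOL-Algebra.Multiplicative_Group"
begin

definition unitary_mat :: "nat \<Rightarrow> complex mat \<Rightarrow> bool" where
  "unitary_mat d U \<longleftrightarrow> U \<in> carrier_mat d d \<and> U * mat_adjoint U = 1\<^sub>m d"

definition unitary_group :: "nat \<Rightarrow> complex mat monoid" where
  "unitary_group d = \<lparr>carrier = {U. unitary_mat d U}, monoid.mult = (*), one = 1\<^sub>m d\<rparr>"

(* A unitary matrix stands for the orthonormal basis formed by its rows, see
   mutually_unbiased_iff_rows below. *)
definition mutually_unbiased :: "nat \<Rightarrow> complex mat \<Rightarrow> complex mat \<Rightarrow> bool" where
  "mutually_unbiased d U V \<longleftrightarrow>
    (\<forall>a<d. \<forall>b<d. cmod ((U * inv\<^bsub>unitary_group d\<^esub> V) $$ (a, b)) = 1 / sqrt (real d))"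

lemma mat_adjoint_index:
  assumes "A \<in> carrier_mat m n" "i < n" "j < m"
  shows "mat_adjoint A $$ (i, j) = conjugate (A $$ (j, i))"
  using assms by (auto simp: mat_adjoint_def mat_of_rows_def)

lemma mat_adjoint_carrier:
  assumes "A \<in> carrier_mat n n"
  shows "mat_adjoint A \<in> carrier_mat n n"
  using assms by (auto simp: mat_adjoint_def)

lemma mult_mat_adjoint_index:
  fixes A B :: "'a :: conjugatable_field mat"
  assumes "A \<in> carrier_mat n n" "B \<in> carrier_mat n n" "i < n" "j < n"
  shows "(A * mat_adjoint B) $$ (i, j) = row A i \<bullet>c row B j"
proof -
  have "col (mat_adjoint B) j = conjugate (row B j)"
    by (rule eq_vecI)
      (use assms mat_adjoint_carrier[OF assms(2)] in \<open>auto simp: mat_adjoint_index[OF assms(2)]\<close>)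
  then show ?thesis
    using assms mat_adjoint_carrier[OF assms(2)] by auto
qed

lemma mat_adjoint_adjoint:
  assumes "A \<in> carrier_mat n n"
  shows "mat_adjoint (mat_adjoint A) = A"
proof (rule eq_matI)
  note c = mat_adjoint_carrier[OF assms] mat_adjoint_carrier[OF mat_adjoint_carrier[OF assms]]
  show "dim_row (mat_adjoint (mat_adjoint A)) = dim_row A"
    "dim_col (mat_adjoint (mat_adjoint A)) = dim_col A" using c assms by auto
  fix i j assume "i < dim_row A" "j < dim_col A"
  then show "mat_adjoint (mat_adjoint A) $$ (i, j) = A $$ (i, j)"
    using assms by (simp add: mat_adjoint_index[OF c(1)] mat_adjoint_index[OF assms])
qed

lemma mat_adjoint_mult:
  fixes A B :: "complex mat"
  assumes "A \<in> carrier_mat n n" "B \<in> carrier_mat n n"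
  shows "mat_adjoint (A * B) = mat_adjoint B * mat_adjoint A"
proof (rule eq_matI)
  note c = mat_adjoint_carrier[OF assms(1)] mat_adjoint_carrier[OF assms(2)]
    mat_adjoint_carrier[OF mult_carrier_mat[OF assms]]
  show "dim_row (mat_adjoint (A * B)) = dim_row (mat_adjoint B * mat_adjoint A)"
    "dim_col (mat_adjoint (A * B)) = dim_col (mat_adjoint B * mat_adjoint A)" using c by auto
  fix i j assume "i < dim_row (mat_adjoint B * mat_adjoint A)"
    "j < dim_col (mat_adjoint B * mat_adjoint A)"
  then have ij: "i < n" "j < n" using c by auto
  have "mat_adjoint (A * B) $$ (i, j) = cnj ((A * B) $$ (j, i))"
    using ij by (simp add: mat_adjoint_index[OF mult_carrier_mat[OF assms]])
  also have "\<dots> = (\<Sum>k<n. cnj (A $$ (j, k)) * cnj (B $$ (k, i)))"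
    using assms ij by (simp add: scalar_prod_def lessThan_atLeast0)
  also have "\<dots> = (\<Sum>k<n. mat_adjoint B $$ (i, k) * mat_adjoint A $$ (k, j))"
    using ij by (intro sum.cong)
      (auto simp: mat_adjoint_index[OF assms(1)] mat_adjoint_index[OF assms(2)])
  also have "\<dots> = (mat_adjoint B * mat_adjoint A) $$ (i, j)"
    using c ij by (simp add: scalar_prod_def lessThan_atLeast0)
  finally show "mat_adjoint (A * B) $$ (i, j) = (mat_adjoint B * mat_adjoint A) $$ (i, j)" .
qed

lemma unitary_mat_adjoint_mult:
  assumes "unitary_mat d U"
  shows "mat_adjoint U * U = 1\<^sub>m d"
  using assms mat_mult_left_right_inverse[OF _ mat_adjoint_carrier]
  by (auto simp: unitary_mat_def)

lemma unitary_mat_adjoint: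
  assumes "unitary_mat d U"
  shows "unitary_mat d (mat_adjoint U)"
  using assms unitary_mat_adjoint_mult[OF assms]
  by (auto simp: unitary_mat_def mat_adjoint_adjoint mat_adjoint_carrier)

lemma unitary_mat_one: "unitary_mat d (1\<^sub>m d)"
proof -
  have "mat_adjoint (1\<^sub>m d) = (1\<^sub>m d :: complex mat)"
    by (rule eq_matI) (auto simp: mat_adjoint_def mat_of_rows_def)
  then show ?thesis by (simp add: unitary_mat_def)
qed

lemma unitary_mat_mult:
  assumes "unitary_mat d U" "unitary_mat d V"
  shows "unitary_mat d (U * V)"
proof -
  have c: "U \<in> carrier_mat d d" "V \<in> carrier_mat d d"
    "mat_adjoint U \<in> carrier_mat d d" "mat_adjoint V \<in> carrier_mat d d"
    using assms by (auto simp: unitary_mat_def mat_adjoint_carrier)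
  have "U * V * mat_adjoint (U * V) = U * V * (mat_adjoint V * mat_adjoint U)"
    using c by (simp add: mat_adjoint_mult)
  also have "\<dots> = U * (V * mat_adjoint V * mat_adjoint U)"
    using c by (simp add: assoc_mult_mat[of _ d d _ d _ d])
  also have "\<dots> = 1\<^sub>m d"
    using assms c by (simp add: unitary_mat_def)
  finally show ?thesis using c by (simp add: unitary_mat_def)
qed

lemma group_unitary_group: "group (unitary_group d)"
proof (rule groupI)
  fix x y z assume "x \<in> carrier (unitary_group d)" "y \<in> carrier (unitary_group d)"
    "z \<in> carrier (unitary_group d)"
  then show "x \<otimes>\<^bsub>unitary_group d\<^esub> y \<otimes>\<^bsub>unitary_group d\<^esub> z
      = x \<otimes>\<^bsub>unitary_group d\<^esub> (y \<otimes>\<^bsub>unitary_group d\<^esub> z)"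
    by (auto simp: unitary_group_def unitary_mat_def assoc_mult_mat[of _ d d _ d _ d])
next
  fix x assume "x \<in> carrier (unitary_group d)"
  then show "\<exists>y\<in>carrier (unitary_group d). y \<otimes>\<^bsub>unitary_group d\<^esub> x = \<one>\<^bsub>unitary_group d\<^esub>"
    by (intro bexI[of _ "mat_adjoint x"])
      (auto simp: unitary_group_def unitary_mat_adjoint unitary_mat_adjoint_mult)
next
  fix x assume "x \<in> carrier (unitary_group d)"
  then show "\<one>\<^bsub>unitary_group d\<^esub> \<otimes>\<^bsub>unitary_group d\<^esub> x = x"
    by (auto simp: unitary_group_def unitary_mat_def)
qed (auto simp: unitary_group_def unitary_mat_one unitary_mat_mult)

lemma inv_unitary_group:
  assumes "U \<in> carrier (unitary_group d)"
  shows "inv\<^bsub>unitary_group d\<^esub> U = mat_adjoint U"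
proof (rule group.inv_equality[OF group_unitary_group _ assms])
  show "mat_adjoint U \<otimes>\<^bsub>unitary_group d\<^esub> U = \<one>\<^bsub>unitary_group d\<^esub>"
    "mat_adjoint U \<in> carrier (unitary_group d)"
    using assms unitary_mat_adjoint unitary_mat_adjoint_mult by (auto simp: unitary_group_def)
qed

lemma pow_unitary_group:
  assumes "U \<in> carrier (unitary_group d)"
  shows "U [^]\<^bsub>unitary_group d\<^esub> (n::nat) = U ^\<^sub>m n"
proof -
  have "dim_row U = d" using assms by (auto simp: unitary_group_def unitary_mat_def)
  then show ?thesis
    by (induction n) (auto simp: unitary_group_def nat_pow_def)
qed

lemma unitary_mat_iff_rows:
  assumes "U \<in> carrier_mat d d"
  shows "unitary_mat d U \<longleftrightarrow>
    (\<forall>a<d. \<forall>b<d. row U a \<bullet>c row U b = (if a = b then 1 else 0))"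
proof -
  have "unitary_mat d U \<longleftrightarrow> (\<forall>a<d. \<forall>b<d. (U * mat_adjoint U) $$ (a, b) = 1\<^sub>m d $$ (a, b))"
    using assms mat_adjoint_carrier[OF assms] by (auto simp: unitary_mat_def mat_eq_iff)
  then show ?thesis
    using assms by (simp add: mult_mat_adjoint_index)
qed

lemma mutually_unbiased_iff_rows:
  assumes "U \<in> carrier (unitary_group d)" "V \<in> carrier (unitary_group d)"
  shows "mutually_unbiased d U V \<longleftrightarrow>
    (\<forall>a<d. \<forall>b<d. (cmod (row U a \<bullet>c row V b))\<^sup>2 = 1 / real d)"
proof -
  have c: "U \<in> carrier_mat d d" "V \<in> carrier_mat d d"
    using assms by (auto simp: unitary_group_def unitary_mat_def)
  have "x = 1 / sqrt (real d) \<longleftrightarrow> x\<^sup>2 = 1 / real d" if "x \<ge> 0" for x :: real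
  proof -
    have "x = 1 / sqrt (real d) \<longleftrightarrow> x\<^sup>2 = (1 / sqrt (real d))\<^sup>2"
      using that by (intro power2_eq_iff_nonneg[symmetric]) auto
    then show ?thesis by (simp add: power_divide)
  qed
  then show ?thesis
    using c by (simp add: mutually_unbiased_def inv_unitary_group[OF assms(2)] mult_mat_adjoint_index)
qed

end

theory Submission
  imports Defs
begin

text \<open>
  The matrix \<open>E = D\<^sup>r\<close> satisfies \<open>E\<^sup>2 = I\<close>, so it is Hermitian and its trace is an integer,
  being a sum of eigenvalues \<open>\<plusminus>1\<close>. Its diagonal entries are real of modulus \<open>1/\<surd>d\<close>, so
  \<open>\<surd>d\<close> times the trace is a sum of \<open>d\<close> signs, which is odd, hence nonzero. Thus \<open>\<surd>d\<close> is
  rational.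
\<close>

definition mat_trace :: "'a::comm_monoid_add mat \<Rightarrow> 'a" where
  "mat_trace A = (\<Sum>i<dim_row A. A $$ (i, i))"

lemma mat_trace_mult_commute:
  fixes A B :: "'a::comm_semiring_0 mat"
  assumes "A \<in> carrier_mat n m" "B \<in> carrier_mat m n"
  shows "mat_trace (A * B) = mat_trace (B * A)"
proof -
  have "mat_trace (A * B) = (\<Sum>i<n. \<Sum>j<m. A $$ (i, j) * B $$ (j, i))"
    using assms by (simp add: mat_trace_def scalar_prod_def lessThan_atLeast0)
  also have "\<dots> = (\<Sum>j<m. \<Sum>i<n. B $$ (j, i) * A $$ (i, j))"
    by (subst sum.swap) (simp add: mult.commute)
  also have "\<dots> = mat_trace (B * A)"
    using assms by (simp add: mat_trace_def scalar_prod_def lessThan_atLeast0)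
  finally show ?thesis .
qed

text \<open>Cyclicity of the trace moves \<open>P\<close> to the right end, where it cancels against
  \<open>Q\<close>.\<close>

lemma mat_trace_similar_wit:
  fixes A B :: "'a::comm_ring_1 mat"
  assumes "A \<in> carrier_mat n n" "similar_mat_wit A B P Q"
  shows "mat_trace A = mat_trace B"
proof -
  note w = similar_mat_witD2[OF assms]
  have "mat_trace A = mat_trace (P * (B * Q))"
    using w by (simp add: assoc_mult_mat[of _ n n _ n _ n])
  also have "\<dots> = mat_trace (B * Q * P)"
    using w by (intro mat_trace_mult_commute) auto
  also have "B * Q * P = B"
    using w by (simp add: assoc_mult_mat[of _ n n _ n _ n])
  finally show ?thesis .
qed

text \<open>The sum lives in a ring such as the complex numbers, where parity has no meaning, so an
  integer \<open>m\<close> carries it. For eigenvalues only integrality is used; for rescaled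
  diagonal entries the parity matters too.\<close>

lemma sum_signs:
  assumes "finite I" "\<And>i. i \<in> I \<Longrightarrow> f i = 1 \<or> f i = (- 1 :: 'a::ring_1)"
  obtains m :: int where "(\<Sum>i\<in>I. f i) = of_int m" "odd m \<longleftrightarrow> odd (card I)"
proof -
  have "\<exists>m::int. (\<Sum>i\<in>I. f i) = of_int m \<and> (odd m \<longleftrightarrow> odd (card I))"
    using assms
  proof (induction I rule: finite_induct)
    case empty
    show ?case by (intro exI[of _ 0]) simp
  next
    case (insert x I)
    then obtain m :: int where m: "(\<Sum>i\<in>I. f i) = of_int m" "odd m \<longleftrightarrow> odd (card I)" by auto
    obtain e :: int where "f x = of_int e" "odd e"
      using insert.prems[of x] by (metis insertI1 of_int_1 of_int_minus odd_one even_minus)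
    then show ?case
      using insert.hyps m by (intro exI[of _ "e + m"]) simp
  qed
  then show ?thesis using that by blast
qed

text \<open>The Schur form \<open>B\<close> of \<open>A\<close> is again an involution, and squaring
  a triangular matrix squares its diagonal. So the diagonal of \<open>B\<close> consists of signs,
  and similarity preserves the trace.\<close>

lemma mat_trace_involution:
  fixes A :: "complex mat"
  assumes A: "A \<in> carrier_mat n n" and sq: "A * A = 1\<^sub>m n"
  obtains t :: int where "mat_trace A = of_int t"
proof -
  obtain es where es: "char_poly A = (\<Prod>a\<leftarrow>es. [:- a, 1:])"
    using char_poly_factorized[OF A] by blast
  obtain B P Q where dec: "schur_decomposition A es = (B, P, Q)"
    by (cases "schur_decomposition A es") auto
  have wit: "similar_mat_wit A B P Q" and ut: "upper_triangular B"
    using schur_decomposition[OF A es dec] by auto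
  note w = similar_mat_witD2[OF A wit]
  note c = w(1,2,5-7) A
  have B: "B \<in> carrier_mat n n" using c by simp
  have "B = Q * A * P"
    using similar_mat_witD2(3)[OF B similar_mat_wit_sym[OF wit]] .
  then have "B * B = Q * A * P * (Q * A * P)" by simp
  also have "\<dots> = Q * A * (P * Q) * (A * P)"
    using c(3-) by (simp add: assoc_mult_mat[of _ n n _ n _ n])
  also have "\<dots> = Q * (A * A) * P"
    using c by (simp add: assoc_mult_mat[of _ n n _ n _ n])
  also have "\<dots> = 1\<^sub>m n"
    using c by (simp add: sq)
  finally have BB: "B * B = 1\<^sub>m n" .
  have "B $$ (i, i) = 1 \<or> B $$ (i, i) = - 1" if i: "i < n" for i
  proof -
    have "1 = (B * B) $$ (i, i)" using i BB by simp
    also have "\<dots> = (\<Sum>k<n. B $$ (i, k) * B $$ (k, i))"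
      using B i by (simp add: scalar_prod_def lessThan_atLeast0)
    \<comment> \<open>Triangularity kills \<open>B $$ (i, k)\<close> for \<open>k < i\<close> and
      \<open>B $$ (k, i)\<close> for \<open>k > i\<close>.\<close>
    also have "\<dots> = (\<Sum>k<n. if k = i then (B $$ (i, i))\<^sup>2 else 0)"
    proof (intro sum.cong refl)
      fix k assume "k \<in> {..<n}"
      then show "B $$ (i, k) * B $$ (k, i) = (if k = i then (B $$ (i, i))\<^sup>2 else 0)"
        using upper_triangularD[OF ut, of i k] upper_triangularD[OF ut, of k i] B i
        by (cases k i rule: linorder_cases) (auto simp: power2_eq_square)
    qed
    also have "\<dots> = (B $$ (i, i))\<^sup>2" using i by simp
    finally show ?thesis by (metis power2_eq_1_iff)
  qed
  then obtain t :: int where "(\<Sum>i<n. B $$ (i, i)) = of_int t"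
    using sum_signs[of "{..<n}" "\<lambda>i. B $$ (i, i)"] by auto
  then show ?thesis
    using that B mat_trace_similar_wit[OF A wit] by (simp add: mat_trace_def)
qed

text \<open>This is the irrationality of the square root of a non-square, stated without fractions:
  if \<open>m / t\<close> squares to \<open>d\<close>, then \<open>t\<close> divides
  \<open>m\<close>.\<close>

lemma square_if_times_square:
  fixes d :: nat and m t :: int
  assumes "m\<^sup>2 = t\<^sup>2 * int d" "m \<noteq> 0"
  shows "\<exists>k. d = k\<^sup>2"
proof -
  have "t dvd m" using assms(1) by (metis dvd_triv_left pow_divides_pow_iff zero_less_numeral)
  then obtain k where k: "m = t * k" ..
  \<comment> \<open>Since \<open>m\<close> is nonzero, so is \<open>t\<close>, and
    \<open>t\<^sup>2\<close> cancels.\<close>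
  then have "int d = k\<^sup>2" using assms by (auto simp: power_mult_distrib)
  then have "d = (nat \<bar>k\<bar>)\<^sup>2"
    by (metis nat_int nat_power_eq abs_ge_zero power2_abs)
  then show ?thesis ..
qed

lemma square_if_involution_flat_diagonal:
  fixes E :: "complex mat"
  assumes "odd d" and E: "unitary_mat d E" and sq: "E * E = 1\<^sub>m d"
    and mod: "\<And>a. a < d \<Longrightarrow> cmod (E $$ (a, a)) = 1 / sqrt (real d)"
  shows "\<exists>k. d = k\<^sup>2"
proof -
  have C: "E \<in> carrier_mat d d" and EE: "mat_adjoint E * E = 1\<^sub>m d"
    using E unitary_mat_adjoint_mult by (auto simp: unitary_mat_def)
  note C' = mat_adjoint_carrier[OF C]
  \<comment> \<open>Both \<open>E\<close> and its adjoint are inverses of \<open>E\<close>, hence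
    they agree.\<close>
  have "mat_adjoint E = mat_adjoint E * (E * E)" using C' sq by simp
  also have "\<dots> = E"
    using C C' EE by (simp add: assoc_mult_mat[of _ d d _ d _ d, symmetric])
  finally have herm: "mat_adjoint E = E" .
  have d: "d > 0" using \<open>odd d\<close> by (cases d) auto
  let ?s = "complex_of_real (sqrt (real d))"
  have "?s * E $$ (a, a) = 1 \<or> ?s * E $$ (a, a) = - 1" if a: "a < d" for a
  proof -
    have "cnj (E $$ (a, a)) = E $$ (a, a)"
      using mat_adjoint_index[OF C a a] herm by simp
    then obtain x where x: "E $$ (a, a) = complex_of_real x"
      by (metis Reals_cnj_iff Reals_cases)
    then have "\<bar>sqrt (real d) * x\<bar> = 1"
      using mod[OF a] d by (simp add: abs_mult)
    then have "sqrt (real d) * x = 1 \<or> sqrt (real d) * x = - 1" by linarith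
    then show ?thesis
      unfolding x by (metis of_real_1 of_real_minus of_real_mult)
  qed
  then obtain m :: int where m: "(\<Sum>a<d. ?s * E $$ (a, a)) = of_int m" "odd m"
    using sum_signs[of "{..<d}" "\<lambda>a. ?s * E $$ (a, a)"] \<open>odd d\<close> by auto
  obtain t :: int where t: "mat_trace E = of_int t"
    using mat_trace_involution[OF C sq] .
  have "of_int m = ?s * of_int t"
    using m(1) t C by (simp add: mat_trace_def sum_distrib_left[symmetric])
  \<comment> \<open>Squaring removes the root, so both sides become images of integers and the
    equation descends to the integers by injectivity of \<open>of_int\<close>.\<close>
  then have "(of_int m)\<^sup>2 = ?s\<^sup>2 * (of_int t)\<^sup>2" by (simp add: power_mult_distrib)
  also have "?s\<^sup>2 = of_nat d" by (simp flip: of_real_power)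
  finally have "(of_int (m\<^sup>2) :: complex) = of_int (t\<^sup>2 * int d)" by (simp add: mult.commute)
  then have "m\<^sup>2 = t\<^sup>2 * int d" by (simp only: of_int_eq_iff)
  then show ?thesis using \<open>odd m\<close> by (intro square_if_times_square) auto
qed

theorem corollary1:
  fixes d :: nat
  assumes "odd d"
    and "\<not> (\<exists>k::nat. d = k ^ 2)"
  shows "\<not> (\<exists>D \<in> carrier (unitary_group d). \<exists>r::nat. r \<ge> 1 \<and>
            group.ord (unitary_group d) D = 2 * r \<and>
            (\<forall>i \<in> {1..2 * r}. \<forall>j \<in> {1..2 * r}. i \<noteq> j \<longrightarrow>
               mutually_unbiased d (D [^]\<^bsub>unitary_group d\<^esub> i) (D [^]\<^bsub>unitary_group d\<^esub> j)))"
proof (rule notI, elim bexE exE conjE)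
  fix D r
  assume D: "D \<in> carrier (unitary_group d)" and r: "r \<ge> 1"
    and ord: "group.ord (unitary_group d) D = 2 * r"
    and mub: "\<forall>i \<in> {1..2 * r}. \<forall>j \<in> {1..2 * r}. i \<noteq> j \<longrightarrow>
      mutually_unbiased d (D [^]\<^bsub>unitary_group d\<^esub> i) (D [^]\<^bsub>unitary_group d\<^esub> j)"
  interpret group "unitary_group d" by (rule group_unitary_group)
  define E where "E = D [^]\<^bsub>unitary_group d\<^esub> r"
  have E: "E \<in> carrier (unitary_group d)" using D by (simp add: E_def)
  have top: "D [^]\<^bsub>unitary_group d\<^esub> (2 * r) = \<one>\<^bsub>unitary_group d\<^esub>"
    using pow_ord_eq_1[OF D] ord by simp
  then have sq: "E \<otimes>\<^bsub>unitary_group d\<^esub> E = \<one>\<^bsub>unitary_group d\<^esub>"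
    using D by (simp add: E_def nat_pow_mult mult_2)
  \<comment> \<open>Unbiasedness constrains the product with an inverse. As \<open>E\<close> is its
    own inverse, comparing it with the identity constrains the entries of \<open>E\<close>
    itself.\<close>
  have "inv\<^bsub>unitary_group d\<^esub> E = E" using inv_equality[OF sq E E] .
  \<comment> \<open>The identity is among the given bases as the power \<open>2 * r\<close>, and
    \<open>r \<ge> 1\<close> makes the exponents \<open>2 * r\<close> and \<open>r\<close>
    distinct.\<close>
  moreover have "mutually_unbiased d \<one>\<^bsub>unitary_group d\<^esub> E"
    using mub[rule_format, of "2 * r" r] r top by (simp add: E_def)
  ultimately have "cmod (E $$ (a, a)) = 1 / sqrt (real d)" if "a < d" for a
    using that E by (auto simp: mutually_unbiased_def unitary_group_def unitary_mat_def)
  then have "\<exists>k. d = k\<^sup>2"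
    using assms(1) E sq
    by (intro square_if_involution_flat_diagonal[of d E]) (auto simp: unitary_group_def)
  then show False using assms(2) by simp
qed

end
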